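(* Let $\{\varphi_i\}_{i\in I}$ and $\{\psi_i\}_{i\in I}$ be frames for a Hilbert space $\mathbb{H}$ with frame bounds $A_1,B_1$ and $A_2,B_2$, respectively. Assume there is a $\lambda$ with $0<\lambda<1$ such that $\lambda(\sqrt{B_1}+\sqrt{B_2})\le \frac{A_1}{2}$ and such that for all sequences of scalars $\{a_i\}_{i\in I}\in\ell^2(I)$, $$\Big\|\sum_{i\in I}a_i(\varphi_i-\psi_i)\Big\|\le\lambda\,\|\{a_i\}_{i\in I}\|_{\ell^2(I)}.$$ Then for every $\sigma\subset I$ the family $\{\varphi_i\}_{i\in\sigma^c}\cup\{\psi_i\}_{i\in\sigma}$ is a frame for $\mathbb{H}$ with frame bounds $\frac{A_1}{2}$ and $B_1+B_2$; that is, $\{\varphi_i\}_{i\in I}$ and $\{\psi_i\}_{i\in I}$ are woven.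
   Context: $I$ is a finite or countably infinite index set and $\sigma^c=I\setminus\sigma$. A family $\{f_i\}_{i\in J}$ in $\mathbb{H}$ is a frame for $\mathbb H$ with (lower, upper) frame bounds $A,B$ if $0<A\le B<\infty$ and $A\|x\|^2\le \sum_{i\in J}|\langle x,f_i\rangle|^2\le B\|x\|^2$ for all $x\in\mathbb{H}$. Unions of families are understood as indexed families (with multiplicity). Two frames $\{\varphi_i\}_{i\in I}$, $\{\psi_i\}_{i\in I}$ are woven if there are universal constants $0<A\le B<\infty$ such that for every $\sigma\subset I$ the family $\{\varphi_i\}_{i\in\sigma}\cup\{\psi_i\}_{i\in\sigma^c}$ is a frame for $\mathbb{H}$ with lower and upper frame bounds $A$ and $B$. *)

theory Defs
  imports "HOL-Analysis.Analysis" "Jordan_Normal_Form.Conjugate"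
begin

text \<open>
  The scalar field of a Hilbert space is the field of real or of complex numbers. This class
  treats the two cases uniformly. By the Gelfand-Mazur theorem a real normed field is isomorphic
  to one of them, and the axiom below forces the conjugation to be the usual one.
\<close>

class hilbert_scalar = real_normed_field + conjugatable_field +
  assumes mult_conjugate: "z * conjugate z = (norm z)\<^sup>2 *\<^sub>R 1"

instance real :: hilbert_scalar
  by standard (simp add: power2_eq_square)

instance complex :: hilbert_scalar
  by standard (simp add: scaleR_conv_of_real complex_norm_square flip: of_real_power)

text \<open>
  The class \<open>banach\<close> supplies the norm, its completeness and the restriction of the scalar
  multiplication to the reals; the inner product, linear in its first argument, induces the norm.
\<close>

locale hilbert_space = vector_space scale
  for scale :: "'k::hilbert_scalar \<Rightarrow> 'h::banach \<Rightarrow> 'h" +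
  fixes ip :: "'h \<Rightarrow> 'h \<Rightarrow> 'k"
  assumes scale_of_real: "scale (of_real r) x = r *\<^sub>R x"
    and ip_add_left: "ip (x + y) z = ip x z + ip y z"
    and ip_scale_left: "ip (scale c x) y = c * ip x y"
    and ip_commute: "ip y x = conjugate (ip x y)"
    and ip_self: "ip x x = of_real ((norm x)\<^sup>2)"

lemma hilbert_space_real:
  "hilbert_space scaleR (inner :: 'h::{real_inner, banach} \<Rightarrow> 'h \<Rightarrow> real)"
  by unfold_locales
    (auto simp: algebra_simps inner_commute power2_norm_eq_inner)

lemma hilbert_space_complex:
  "hilbert_space (*) (\<lambda>x y::complex. x * cnj y)"
  by unfold_locales
    (auto simp: algebra_simps scaleR_conv_of_real complex_norm_square simp del: of_real_power)

definition is_frame_with ::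
  "('h::real_normed_vector \<Rightarrow> 'h \<Rightarrow> 'k::real_normed_field) \<Rightarrow> 'j set \<Rightarrow> ('j \<Rightarrow> 'h) \<Rightarrow> real \<Rightarrow> real \<Rightarrow> bool"
  where "is_frame_with ip J f A B \<longleftrightarrow> 0 < A \<and> A \<le> B \<and>
    (\<forall>x. (\<lambda>j. (norm (ip x (f j)))\<^sup>2) summable_on J \<and>
         A * (norm x)\<^sup>2 \<le> (\<Sum>\<^sub>\<infinity>j\<in>J. (norm (ip x (f j)))\<^sup>2) \<and>
         (\<Sum>\<^sub>\<infinity>j\<in>J. (norm (ip x (f j)))\<^sup>2) \<le> B * (norm x)\<^sup>2)"

text \<open>
  Unions of families are families over the disjoint sum of the index sets: the family
  \<open>f\<close> over \<open>J\<close> united with \<open>g\<close> over \<open>K\<close> is \<open>case_sum f g\<close> over \<open>J <+> K\<close>.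
\<close>

definition woven ::
  "('h::real_normed_vector \<Rightarrow> 'h \<Rightarrow> 'k::real_normed_field) \<Rightarrow> 'i set \<Rightarrow> ('i \<Rightarrow> 'h) \<Rightarrow> ('i \<Rightarrow> 'h) \<Rightarrow> bool"
  where "woven ip I \<phi> \<psi> \<longleftrightarrow>
    (\<exists>A B. is_frame_with ip I \<phi> A B) \<and> (\<exists>A B. is_frame_with ip I \<psi> A B) \<and>
    (\<exists>A B. 0 < A \<and> A \<le> B \<and>
      (\<forall>\<sigma>\<subseteq>I. is_frame_with ip (\<sigma> <+> (I - \<sigma>)) (case_sum \<phi> \<psi>) A B))"

end

theory Submission
  imports Defs
begin

text \<open>
  Fix \<open>x\<close> and write \<open>p\<^sub>i = |\<langle>x, \<phi>\<^sub>i\<rangle>|\<close>, \<open>q\<^sub>i = |\<langle>x, \<psi>\<^sub>i\<rangle>|\<close>, \<open>d\<^sub>i = |\<langle>x, \<phi>\<^sub>i - \<psi>\<^sub>i\<rangle>|\<close>. Replacing \<open>\<phi>\<^sub>i\<close> by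
  \<open>\<psi>\<^sub>i\<close> on a set \<open>\<sigma>\<close> lowers \<open>\<Sum> p\<^sub>i\<^sup>2 \<ge> A\<^sub>1 \<parallel>x\<parallel>\<^sup>2\<close> by \<open>\<Sum>\<^sub>\<sigma> (p\<^sub>i\<^sup>2 - q\<^sub>i\<^sup>2)\<close>, and since
  \<open>|p\<^sub>i - q\<^sub>i| \<le> d\<^sub>i\<close>, the Cauchy-Schwarz inequality in \<open>\<ell>\<^sup>2\<close> bounds this loss by
  \<open>\<parallel>d\<parallel> (\<parallel>p\<parallel> + \<parallel>q\<parallel>)\<close>. The upper frame bounds control \<open>\<parallel>p\<parallel>\<close> and \<open>\<parallel>q\<parallel>\<close> by \<open>\<surd>B\<^sub>1 \<parallel>x\<parallel>\<close> and
  \<open>\<surd>B\<^sub>2 \<parallel>x\<parallel>\<close>. The hypothesis on synthesis says that \<open>a \<mapsto> \<Sum> a\<^sub>i (\<phi>\<^sub>i - \<psi>\<^sub>i)\<close> has operator norm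
  at most \<open>\<lambda>\<close> (the number called \<open>l\<close> below); its adjoint sends \<open>x\<close> to the coefficients
  \<open>\<langle>x, \<phi>\<^sub>i - \<psi>\<^sub>i\<rangle>\<close> and has the same norm, so \<open>\<parallel>d\<parallel> \<le> \<lambda> \<parallel>x\<parallel>\<close> (\<open>analysis_bound_of_synthesis_bound\<close>). Hence at most
  \<open>\<lambda> (\<surd>B\<^sub>1 + \<surd>B\<^sub>2) \<parallel>x\<parallel>\<^sup>2 \<le> A\<^sub>1/2 \<parallel>x\<parallel>\<^sup>2\<close> is lost. The upper bound \<open>B\<^sub>1 + B\<^sub>2\<close> is the
  sum of the upper bounds of the two pieces.

  The estimates are made on finite index sets, where \<open>L2_set\<close> supplies the Cauchy-Schwarz
  inequality and the synthesis hypothesis is applied to finitely supported coefficients;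
  the bounds are uniform and pass to the infinite sums.
\<close>

lemma norm_conjugate:
  fixes z :: "'k::hilbert_scalar"
  shows "norm (conjugate z) = norm z"
proof (cases "z = 0")
  case False
  have "norm (z * conjugate z) = (norm z)\<^sup>2"
    by (simp add: mult_conjugate)
  then show ?thesis
    using False by (simp add: norm_mult power2_eq_square)
qed simp

context hilbert_space
begin

lemma ip_scale_right: "ip x (scale c y) = conjugate c * ip x y"
  by (metis conjugate_dist_mul ip_commute ip_scale_left)

lemma ip_add_right: "ip x (y + z) = ip x y + ip x z"
  by (metis conjugate_dist_add ip_commute ip_add_left)

lemma ip_zero_left: "ip 0 x = 0"
  using ip_add_left[of 0 0 x] by simp

lemma ip_diff_left: "ip (x - y) z = ip x z - ip y z"
  using ip_add_left[of "x - y" y z] by simp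

lemma ip_diff_right: "ip x (y - z) = ip x y - ip x z"
  using ip_add_right[of x "y - z" z] by simp

lemma ip_sum_left: "finite F \<Longrightarrow> ip (\<Sum>i\<in>F. f i) x = (\<Sum>i\<in>F. ip (f i) x)"
  by (induction F rule: finite_induct) (simp_all add: ip_zero_left ip_add_left)

lemma norm_ip_commute: "norm (ip y x) = norm (ip x y)"
  by (metis ip_commute norm_conjugate)

lemma ip_cauchy_schwarz: "norm (ip x y) \<le> norm x * norm y"
proof (cases "y = 0")
  case True
  then show ?thesis
    using norm_ip_commute[of x 0] by (simp add: ip_zero_left)
next
  case False
  define q where "q = (of_real ((norm y)\<^sup>2) :: 'k)"
  \<comment> \<open>the component of \<open>x\<close> orthogonal to \<open>y\<close>, cleared of its denominator\<close>
  define z where "z = scale q x - scale (ip x y) y"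
  have yy: "ip y y = q"
    by (simp add: q_def ip_self)
  have cq: "conjugate q = q"
    using ip_commute[of y y] yy by simp
  have zy: "ip z y = 0"
    by (simp add: z_def ip_diff_left ip_scale_left yy)
  have "ip z z = conjugate q * ip z x - conjugate (ip x y) * ip z y"
    by (subst (2) z_def) (simp add: ip_diff_right ip_scale_right)
  also have "\<dots> = q * (q * ip x x - ip x y * conjugate (ip x y))"
    by (simp add: zy cq) (simp add: z_def ip_diff_left ip_scale_left flip: ip_commute)
  also have "\<dots> = of_real ((norm y)\<^sup>2 * ((norm y)\<^sup>2 * (norm x)\<^sup>2 - (norm (ip x y))\<^sup>2))"
    by (simp add: q_def ip_self mult_conjugate scaleR_conv_of_real)
  finally have "(norm z)\<^sup>2 = (norm y)\<^sup>2 * ((norm y)\<^sup>2 * (norm x)\<^sup>2 - (norm (ip x y))\<^sup>2)"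
    by (simp only: ip_self of_real_eq_iff)
  then have "0 \<le> (norm y)\<^sup>2 * ((norm y)\<^sup>2 * (norm x)\<^sup>2 - (norm (ip x y))\<^sup>2)"
    by (metis zero_le_power2)
  then have "(norm (ip x y))\<^sup>2 \<le> (norm x * norm y)\<^sup>2"
    using False by (simp add: zero_le_mult_iff power_mult_distrib mult.commute)
  then show ?thesis
    by (rule power2_le_imp_le) simp
qed

text \<open>
  The adjoint of a bounded operator has the same norm. With \<open>a\<^sub>i = \<langle>x, f\<^sub>i\<rangle>\<close> one has
  \<open>\<parallel>a\<parallel>\<^sup>2 = \<langle>\<Sum> a\<^sub>i f\<^sub>i, x\<rangle> \<le> c \<parallel>a\<parallel> \<parallel>x\<parallel>\<close>, and \<open>\<parallel>a\<parallel>\<close> cancels.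
\<close>

lemma analysis_bound_of_synthesis_bound:
  assumes "finite F"
    and synthesis: "\<And>a. norm (\<Sum>i\<in>F. scale (a i) (f i)) \<le> c * L2_set (\<lambda>i. norm (a i)) F"
    and "0 \<le> c"
  shows "L2_set (\<lambda>i. norm (ip x (f i))) F \<le> c * norm x"
proof -
  define a where "a i = ip x (f i)" for i
  define s where "s = L2_set (\<lambda>i. norm (a i)) F"
  have s2: "s\<^sup>2 = (\<Sum>i\<in>F. (norm (a i))\<^sup>2)"
    by (simp add: s_def L2_set_def sum_nonneg)
  have "of_real (s\<^sup>2) = (\<Sum>i\<in>F. a i * conjugate (a i))"
    by (simp add: s2 mult_conjugate scaleR_conv_of_real)
  also have "\<dots> = ip (\<Sum>i\<in>F. scale (a i) (f i)) x"
    using \<open>finite F\<close> by (simp add: ip_sum_left ip_scale_left a_def flip: ip_commute)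
  finally have "s\<^sup>2 = norm (ip (\<Sum>i\<in>F. scale (a i) (f i)) x)"
    by (metis abs_of_nonneg norm_of_real zero_le_power2)
  also have "\<dots> \<le> norm (\<Sum>i\<in>F. scale (a i) (f i)) * norm x"
    by (rule ip_cauchy_schwarz)
  also have "\<dots> \<le> c * s * norm x"
    unfolding s_def by (intro mult_right_mono synthesis) simp
  finally have "s * s \<le> s * (c * norm x)"
    by (simp add: power2_eq_square mult_ac)
  moreover have "0 \<le> s"
    by (simp add: s_def L2_set_nonneg)
  ultimately have "s \<le> c * norm x"
    using \<open>0 \<le> c\<close> by (cases "s = 0") (auto simp: mult_le_cancel_left)
  then show ?thesis
    by (simp add: s_def a_def)
qed

end

text \<open>
  The \<open>\<ell>\<^sup>2\<close> form of \<open>p\<^sup>2 - q\<^sup>2 = (p - q)(p + q)\<close>.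
\<close>

lemma sum_power2_diff_le_L2_set:
  fixes p q d :: "'i \<Rightarrow> real"
  assumes "\<And>i. i \<in> F \<Longrightarrow> \<bar>p i - q i\<bar> \<le> d i"
  shows "(\<Sum>i\<in>F. (p i)\<^sup>2 - (q i)\<^sup>2) \<le> L2_set d F * (L2_set p F + L2_set q F)"
proof -
  have "(\<Sum>i\<in>F. (p i)\<^sup>2 - (q i)\<^sup>2) = (\<Sum>i\<in>F. (p i - q i) * (p i + q i))"
    by (simp add: power2_eq_square algebra_simps)
  also have "\<dots> \<le> (\<Sum>i\<in>F. \<bar>d i\<bar> * \<bar>p i + q i\<bar>)"
  proof (rule sum_mono)
    fix i assume "i \<in> F"
    then have "\<bar>p i - q i\<bar> * \<bar>p i + q i\<bar> \<le> \<bar>d i\<bar> * \<bar>p i + q i\<bar>"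
      using assms[of i] by (intro mult_right_mono) auto
    then show "(p i - q i) * (p i + q i) \<le> \<bar>d i\<bar> * \<bar>p i + q i\<bar>"
      by (metis abs_ge_self abs_mult order_trans)
  qed
  also have "\<dots> \<le> L2_set d F * L2_set (\<lambda>i. p i + q i) F"
    by (rule L2_set_mult_ineq)
  also have "\<dots> \<le> L2_set d F * (L2_set p F + L2_set q F)"
    by (intro mult_left_mono L2_set_triangle_ineq L2_set_nonneg)
  finally show ?thesis .
qed

lemma has_sum_Plus:
  fixes h :: "'a + 'b \<Rightarrow> 'c::topological_comm_monoid_add"
  assumes "((\<lambda>i. h (Inl i)) has_sum a) A" and "((\<lambda>j. h (Inr j)) has_sum b) B"
  shows "(h has_sum (a + b)) (A <+> B)"
  unfolding Plus_def
proof (rule has_sum_Un_disjoint)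
  show "(h has_sum a) (Inl ` A)"
    using assms(1) by (subst has_sum_reindex) (auto simp: o_def)
  show "(h has_sum b) (Inr ` B)"
    using assms(2) by (subst has_sum_reindex) (auto simp: o_def)
qed auto

lemma is_frame_with_L2_set_le:
  assumes "is_frame_with ip I f A B" and "finite F" and "F \<subseteq> I"
  shows "L2_set (\<lambda>i. norm (ip x (f i))) F \<le> sqrt B * norm x"
proof -
  have "(\<Sum>i\<in>F. (norm (ip x (f i)))\<^sup>2) \<le> (\<Sum>\<^sub>\<infinity>i\<in>I. (norm (ip x (f i)))\<^sup>2)"
    using assms unfolding is_frame_with_def by (intro finite_sum_le_infsum) auto
  also have "\<dots> \<le> B * (norm x)\<^sup>2"
    using assms unfolding is_frame_with_def by blast
  finally have "sqrt (\<Sum>i\<in>F. (norm (ip x (f i)))\<^sup>2) \<le> sqrt (B * (norm x)\<^sup>2)"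
    by (rule real_sqrt_le_mono)
  then show ?thesis
    by (simp add: L2_set_def real_sqrt_mult)
qed

lemma infsum_subset_le_upper_frame_bound:
  assumes "is_frame_with ip I f A B" and "J \<subseteq> I"
  shows "(\<Sum>\<^sub>\<infinity>i\<in>J. (norm (ip x (f i)))\<^sup>2) \<le> B * (norm x)\<^sup>2"
proof -
  have summable: "(\<lambda>i. (norm (ip x (f i)))\<^sup>2) summable_on I"
    and upper: "(\<Sum>\<^sub>\<infinity>i\<in>I. (norm (ip x (f i)))\<^sup>2) \<le> B * (norm x)\<^sup>2"
    using assms(1) by (auto simp: is_frame_with_def)
  have "(\<Sum>\<^sub>\<infinity>i\<in>J. (norm (ip x (f i)))\<^sup>2) \<le> (\<Sum>\<^sub>\<infinity>i\<in>I. (norm (ip x (f i)))\<^sup>2)"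
    using summable assms(2) by (intro infsum_mono2 summable_on_subset_banach[OF summable]) auto
  with upper show ?thesis by linarith
qed

theorem theorem6p1:
  fixes scale :: "'k::hilbert_scalar \<Rightarrow> 'h::banach \<Rightarrow> 'h"
    and ip :: "'h \<Rightarrow> 'h \<Rightarrow> 'k"
    and I :: "'i set"
    and \<phi> \<psi> :: "'i \<Rightarrow> 'h"
    and A\<^sub>1 B\<^sub>1 A\<^sub>2 B\<^sub>2 l :: real
  assumes "hilbert_space scale ip"
    and "countable I"
    and "is_frame_with ip I \<phi> A\<^sub>1 B\<^sub>1"
    and "is_frame_with ip I \<psi> A\<^sub>2 B\<^sub>2"
    and "0 < l" and "l < 1"
    and "l * (sqrt B\<^sub>1 + sqrt B\<^sub>2) \<le> A\<^sub>1 / 2"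
    and "\<And>a :: 'i \<Rightarrow> 'k. (\<lambda>i. (norm (a i))\<^sup>2) summable_on I \<Longrightarrow>
           norm (\<Sum>\<^sub>\<infinity>i\<in>I. scale (a i) (\<phi> i - \<psi> i)) \<le> l * sqrt (\<Sum>\<^sub>\<infinity>i\<in>I. (norm (a i))\<^sup>2)"
  shows "(\<forall>\<sigma>\<subseteq>I. is_frame_with ip ((I - \<sigma>) <+> \<sigma>) (case_sum \<phi> \<psi>) (A\<^sub>1 / 2) (B\<^sub>1 + B\<^sub>2)) \<and>
         woven ip I \<phi> \<psi>"
proof -
  interpret hilbert_space scale ip by (rule assms(1))
  note frames = assms(3,4)
  have bounds: "0 < A\<^sub>1" "A\<^sub>1 \<le> B\<^sub>1" "0 < A\<^sub>2" "A\<^sub>2 \<le> B\<^sub>2"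
    using frames by (auto simp: is_frame_with_def)
  define p q where "p x i = norm (ip x (\<phi> i))" and "q x i = norm (ip x (\<psi> i))" for x i

  have synthesis: "norm (\<Sum>i\<in>F. scale (a i) (\<phi> i - \<psi> i)) \<le> l * L2_set (\<lambda>i. norm (a i)) F"
    if F: "finite F" "F \<subseteq> I" for F a
  proof -
    define b where "b i = (if i \<in> F then a i else 0)" for i
    have sq: "((\<lambda>i. (norm (b i))\<^sup>2) has_sum (\<Sum>i\<in>F. (norm (a i))\<^sup>2)) I"
      using F by (intro has_sum_finite_neutralI) (auto simp: b_def)
    have "((\<lambda>i. scale (b i) (\<phi> i - \<psi> i)) has_sum (\<Sum>i\<in>F. scale (a i) (\<phi> i - \<psi> i))) I"
      using F by (intro has_sum_finite_neutralI) (auto simp: b_def)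
    then have "(\<Sum>\<^sub>\<infinity>i\<in>I. scale (b i) (\<phi> i - \<psi> i)) = (\<Sum>i\<in>F. scale (a i) (\<phi> i - \<psi> i))"
      by (rule infsumI)
    moreover note assms(8)[OF has_sum_imp_summable[OF sq]]
    ultimately show ?thesis
      by (simp add: infsumI[OF sq] L2_set_def)
  qed

  have loss_finite: "(\<Sum>i\<in>F. (p x i)\<^sup>2 - (q x i)\<^sup>2) \<le> A\<^sub>1 / 2 * (norm x)\<^sup>2"
    if F: "finite F" "F \<subseteq> I" for F x
  proof -
    let ?d = "\<lambda>i. norm (ip x (\<phi> i - \<psi> i))"
    have "(\<Sum>i\<in>F. (p x i)\<^sup>2 - (q x i)\<^sup>2) \<le> L2_set ?d F * (L2_set (p x) F + L2_set (q x) F)"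
      by (rule sum_power2_diff_le_L2_set) (simp add: p_def q_def ip_diff_right norm_triangle_ineq3)
    also have "\<dots> \<le> (l * norm x) * (sqrt B\<^sub>1 * norm x + sqrt B\<^sub>2 * norm x)"
      unfolding p_def q_def using F frames \<open>0 < l\<close>
      by (intro mult_mono add_mono add_nonneg_nonneg L2_set_nonneg
          analysis_bound_of_synthesis_bound synthesis is_frame_with_L2_set_le) auto
    also have "\<dots> = l * (sqrt B\<^sub>1 + sqrt B\<^sub>2) * (norm x)\<^sup>2"
      by (simp add: power2_eq_square algebra_simps)
    also have "\<dots> \<le> A\<^sub>1 / 2 * (norm x)\<^sup>2"
      by (intro mult_right_mono assms(7)) simp
    finally show ?thesis .
  qed

  have weaving: "is_frame_with ip ((I - \<sigma>) <+> \<sigma>) (case_sum \<phi> \<psi>) (A\<^sub>1 / 2) (B\<^sub>1 + B\<^sub>2)"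
    if \<sigma>: "\<sigma> \<subseteq> I" for \<sigma>
    unfolding is_frame_with_def
  proof (intro conjI allI)
    show "0 < A\<^sub>1 / 2" "A\<^sub>1 / 2 \<le> B\<^sub>1 + B\<^sub>2"
      using bounds by auto
    fix x
    let ?h = "\<lambda>j. (norm (ip x (case_sum \<phi> \<psi> j)))\<^sup>2"
    have p: "(\<lambda>i. (p x i)\<^sup>2) summable_on J" and q: "(\<lambda>i. (q x i)\<^sup>2) summable_on J" if "J \<subseteq> I" for J
      using frames that unfolding is_frame_with_def p_def q_def
      by (meson summable_on_subset_banach)+
    have h: "(?h has_sum ((\<Sum>\<^sub>\<infinity>i\<in>I - \<sigma>. (p x i)\<^sup>2) + (\<Sum>\<^sub>\<infinity>i\<in>\<sigma>. (q x i)\<^sup>2))) ((I - \<sigma>) <+> \<sigma>)"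
      using has_sum_infsum[OF p[of "I - \<sigma>"]] has_sum_infsum[OF q[OF \<sigma>]]
      by (intro has_sum_Plus) (auto simp: p_def q_def)
    then show "?h summable_on ((I - \<sigma>) <+> \<sigma>)"
      by (rule has_sum_imp_summable)

    have "((\<lambda>i. (p x i)\<^sup>2 - (q x i)\<^sup>2) has_sum
        ((\<Sum>\<^sub>\<infinity>i\<in>\<sigma>. (p x i)\<^sup>2) - (\<Sum>\<^sub>\<infinity>i\<in>\<sigma>. (q x i)\<^sup>2))) \<sigma>"
      using has_sum_add[OF has_sum_infsum[OF p[OF \<sigma>]],
          of "\<lambda>i. - ((q x i)\<^sup>2)" "- (\<Sum>\<^sub>\<infinity>i\<in>\<sigma>. (q x i)\<^sup>2)"] has_sum_infsum[OF q[OF \<sigma>]]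
      by (simp add: has_sum_uminus)
    then have loss: "(\<Sum>\<^sub>\<infinity>i\<in>\<sigma>. (p x i)\<^sup>2) - (\<Sum>\<^sub>\<infinity>i\<in>\<sigma>. (q x i)\<^sup>2) \<le> A\<^sub>1 / 2 * (norm x)\<^sup>2"
      by (rule has_sum_le_finite_sums) (rule loss_finite[OF _ subset_trans[OF _ \<sigma>]])
    have split: "(\<Sum>\<^sub>\<infinity>i\<in>I. (p x i)\<^sup>2) = (\<Sum>\<^sub>\<infinity>i\<in>I - \<sigma>. (p x i)\<^sup>2) + (\<Sum>\<^sub>\<infinity>i\<in>\<sigma>. (p x i)\<^sup>2)"
      using infsum_Un_disjoint[OF p[of "I - \<sigma>"] p[OF \<sigma>]] Diff_partition[OF \<sigma>]
      by (simp add: Un_commute Int_commute)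
    have "A\<^sub>1 * (norm x)\<^sup>2 \<le> (\<Sum>\<^sub>\<infinity>i\<in>I. (p x i)\<^sup>2)"
      using frames(1) by (simp add: is_frame_with_def p_def)
    with loss split show "A\<^sub>1 / 2 * (norm x)\<^sup>2 \<le> (\<Sum>\<^sub>\<infinity>j\<in>(I - \<sigma>) <+> \<sigma>. ?h j)"
      by (simp add: infsumI[OF h])

    have "(\<Sum>\<^sub>\<infinity>i\<in>I - \<sigma>. (p x i)\<^sup>2) \<le> B\<^sub>1 * (norm x)\<^sup>2"
      unfolding p_def using frames(1) by (rule infsum_subset_le_upper_frame_bound) auto
    moreover have "(\<Sum>\<^sub>\<infinity>i\<in>\<sigma>. (q x i)\<^sup>2) \<le> B\<^sub>2 * (norm x)\<^sup>2"
      unfolding q_def using frames(2) \<sigma> by (rule infsum_subset_le_upper_frame_bound)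
    ultimately show "(\<Sum>\<^sub>\<infinity>j\<in>(I - \<sigma>) <+> \<sigma>. ?h j) \<le> (B\<^sub>1 + B\<^sub>2) * (norm x)\<^sup>2"
      by (simp add: infsumI[OF h] distrib_right)
  qed

  \<comment> \<open>Wovenness keeps \<open>\<phi>\<close> on \<open>\<sigma>\<close> itself, hence the passage to the complement.\<close>
  have "is_frame_with ip (\<sigma> <+> (I - \<sigma>)) (case_sum \<phi> \<psi>) (A\<^sub>1 / 2) (B\<^sub>1 + B\<^sub>2)" if "\<sigma> \<subseteq> I" for \<sigma>
    using weaving[of "I - \<sigma>"] that by (simp add: double_diff)
  moreover have "0 < A\<^sub>1 / 2" "A\<^sub>1 / 2 \<le> B\<^sub>1 + B\<^sub>2"
    using bounds by auto
  ultimately have "woven ip I \<phi> \<psi>"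
    unfolding woven_def using frames by blast
  with weaving show ?thesis by blast
qed

end
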